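(* Let $m$ and $n$ be coprime positive integers and let $\delta$ be a real number with $\sin\delta\neq 0$. Then the polynomial $$T_n(x)^2-2T_n(x)T_m(y)\cos\delta+T_m(y)^2-\sin^2\delta$$ is irreducible in $\mathbb{C}[x,y]$.
   Context: For a nonnegative integer $k$, $T_k$ denotes the $k$-th Chebyshev polynomial of the first kind, i.e. the unique polynomial with $T_k(\cos\theta)=\cos k\theta$ for all real $\theta$. *)

theory Defs
  imports Complex_Main "HOL-Computational_Algebra.Computational_Algebra"
begin

definition cheb_poly :: "nat \<Rightarrow> complex poly" where
  "cheb_poly k = (THE p. \<forall>\<theta>::real.
     poly p (complex_of_real (cos \<theta>)) = complex_of_real (cos (real k * \<theta>)))"

lemma cheb_poly_unique:
  fixes p q :: "complex poly"
  assumes "\<forall>\<theta>::real. poly p (complex_of_real (cos \<theta>)) = complex_of_real (cos (real k * \<theta>))"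
    and "\<forall>\<theta>::real. poly q (complex_of_real (cos \<theta>)) = complex_of_real (cos (real k * \<theta>))"
  shows "p = q"
proof (rule ccontr)
  assume "p \<noteq> q"
  then have "p - q \<noteq> 0" by simp
  then have fin: "finite {z. poly (p - q) z = 0}" by (rule poly_roots_finite)
  have "complex_of_real ` {0..1} \<subseteq> {z. poly (p - q) z = 0}"
  proof
    fix z assume "z \<in> complex_of_real ` {0..1}"
    then obtain t where t: "z = complex_of_real t" "0 \<le> t" "t \<le> 1" by auto
    have "cos (arccos t) = t" using t by simp
    then show "z \<in> {z. poly (p - q) z = 0}"
      using assms(1)[rule_format, of "arccos t"] assms(2)[rule_format, of "arccos t"] t by simp
  qed
  then have "finite (complex_of_real ` {0..1})" using fin finite_subset by blast
  then have "finite {0..1::real}" by (rule finite_imageD) (simp add: inj_on_def)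
  then show False using infinite_Icc[of 0 "1::real"] by simp
qed

lemma cheb_poly_exists:
  "\<exists>p::complex poly. \<forall>\<theta>::real.
     poly p (complex_of_real (cos \<theta>)) = complex_of_real (cos (real k * \<theta>))"
proof (induction k rule: less_induct)
  case (less k)
  show ?case
  proof (cases "k < 2")
    case True
    then consider "k = 0" | "k = 1" by linarith
    then show ?thesis
    proof cases
      case 1
      then show ?thesis by (intro exI[of _ "1"]) simp
    next
      case 2
      then show ?thesis by (intro exI[of _ "[:0, 1:]"]) simp
    qed
  next
    case False
    then obtain j where k: "k = Suc (Suc j)" by (metis less_2_cases_iff not0_implies_Suc One_nat_def)
    from less[of j] k obtain p :: "complex poly" where p: "\<forall>\<theta>::real.
      poly p (complex_of_real (cos \<theta>)) = complex_of_real (cos (real j * \<theta>))" by auto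
    from less[of "Suc j"] k obtain q :: "complex poly" where q: "\<forall>\<theta>::real.
      poly q (complex_of_real (cos \<theta>)) = complex_of_real (cos (real (Suc j) * \<theta>))" by auto
    have "cos (real k * \<theta>) = 2 * cos \<theta> * cos (real (Suc j) * \<theta>) - cos (real j * \<theta>)" for \<theta> :: real
    proof -
      have "real k * \<theta> = real (Suc j) * \<theta> + \<theta>" "real j * \<theta> = real (Suc j) * \<theta> - \<theta>"
        using k by (simp_all add: algebra_simps)
      then show ?thesis by (simp only: cos_add cos_diff) simp
    qed
    then show ?thesis
      using p q by (intro exI[of _ "[:0, 2:] * q - p"]) simp
  qed
qed

lemma cheb_poly_cos:
  fixes \<theta> :: real
  shows "poly (cheb_poly k) (complex_of_real (cos \<theta>)) = complex_of_real (cos (real k * \<theta>))"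
proof -
  have "\<exists>!p::complex poly. \<forall>\<theta>::real.
     poly p (complex_of_real (cos \<theta>)) = complex_of_real (cos (real k * \<theta>))"
    using cheb_poly_exists cheb_poly_unique by blast
  from theI'[OF this] show ?thesis unfolding cheb_poly_def by blast
qed

text \<open>The ring \<open>\<complex>[x,y]\<close> is represented as \<open>\<complex>[x][y]\<close>: the outer variable of
  \<^typ>\<open>complex poly poly\<close> is \<open>y\<close>, the inner one is \<open>x\<close>.\<close>

definition in_x :: "complex poly \<Rightarrow> complex poly poly" where
  "in_x p = [:p:]"

definition in_y :: "complex poly \<Rightarrow> complex poly poly" where
  "in_y p = map_poly (\<lambda>c. [:c:]) p"

definition scalar :: "complex \<Rightarrow> complex poly poly" where
  "scalar c = [:[:c:]:]"

lemma poly_in_x: "poly (poly (in_x p) [:b:]) a = poly p a"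
  by (simp add: in_x_def)

lemma poly_in_y: "poly (poly (in_y p) [:b:]) a = poly p b"
  unfolding in_y_def by (induction p) (auto simp: map_poly_pCons)

lemma poly_scalar: "poly (poly (scalar c) [:b:]) a = c"
  by (simp add: scalar_def)

end

theory Submission
  imports Defs
begin

text \<open>The curve is the Lissajous curve \<open>x = (z\<^sup>m + z\<^sup>-\<^sup>m) / 2\<close>, \<open>y = (w z\<^sup>n + w\<^sup>-\<^sup>1 z\<^sup>-\<^sup>n) / 2\<close> with
  \<open>w = exp (\<i> \<delta> / m)\<close>: on the unit circle \<open>z = exp (\<i> t)\<close> these are \<open>cos (m t)\<close> and
  \<open>cos (n t + \<delta> / m)\<close>. If the polynomial is a product, one of the factors vanishes at infinitely
  many points of the unit circle, hence, being a Laurent polynomial in \<open>z\<close>, for all \<open>z \<noteq> 0\<close>.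
  The fibre of \<open>x\<close> through \<open>z = 2\<close> has \<open>2m\<close> points, and \<open>y\<close> separates them because \<open>m\<close> and \<open>n\<close> are
  coprime and \<open>w\<^sup>2\<^sup>m \<noteq> 1\<close>. So this factor has degree at least \<open>2m\<close> in \<open>y\<close>, which is the
  degree of the product; as the leading coefficient in \<open>y\<close> is constant, the other factor is a unit.\<close>

section \<open>Chebyshev polynomials\<close>

lemma cheb_poly_Suc_Suc: "cheb_poly (Suc (Suc k)) = [:0, 2:] * cheb_poly (Suc k) - cheb_poly k"
proof (rule cheb_poly_unique[where k = "Suc (Suc k)"]; intro allI)
  fix \<theta> :: real
  show "poly (cheb_poly (Suc (Suc k))) (complex_of_real (cos \<theta>)) =
      complex_of_real (cos (real (Suc (Suc k)) * \<theta>))"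
    by (rule cheb_poly_cos)
  have "real (Suc (Suc k)) * \<theta> = real (Suc k) * \<theta> + \<theta>" "real k * \<theta> = real (Suc k) * \<theta> - \<theta>"
    by (simp_all add: algebra_simps)
  then have "cos (real (Suc (Suc k)) * \<theta>) = 2 * cos \<theta> * cos (real (Suc k) * \<theta>) - cos (real k * \<theta>)"
    by (simp only: cos_add cos_diff) simp
  then show "poly ([:0, 2:] * cheb_poly (Suc k) - cheb_poly k) (complex_of_real (cos \<theta>)) =
      complex_of_real (cos (real (Suc (Suc k)) * \<theta>))"
    by (simp add: cheb_poly_cos del: of_nat_Suc)
qed

text \<open>An upper bound is all the root count asks for: the degree in \<open>y\<close> of the
  product must not exceed the \<open>2 * m\<close> values of \<open>y\<close> found on one
  fibre.\<close>

lemma degree_cheb_poly_le: "degree (cheb_poly k) \<le> k"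
proof (induction k rule: induct_nat_012)
  case 0
  have "cheb_poly 0 = 1"
    by (rule cheb_poly_unique[where k = 0]) (simp_all add: cheb_poly_cos)
  then show ?case by simp
next
  case 1
  have "cheb_poly 1 = [:0, 1:]"
    by (rule cheb_poly_unique[where k = 1]) (simp_all add: cheb_poly_cos)
  then show ?case by simp
next
  case (ge2 k)
  have "degree ([:0, 2:] * cheb_poly (Suc k)) \<le> Suc (Suc k)"
    using degree_mult_le[of "[:0, 2::complex:]" "cheb_poly (Suc k)"] ge2 by simp
  then show ?case
    unfolding cheb_poly_Suc_Suc using ge2 by (intro degree_diff_le) simp_all
qed

text \<open>The values at \<open>cos 0\<close> and \<open>cos (pi / k)\<close> are 1 and -1, so the
  polynomial is not constant.\<close>

lemma degree_cheb_poly_pos: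
  assumes "k > 0"
  shows "degree (cheb_poly k) > 0"
proof (rule ccontr)
  assume "\<not> ?thesis"
  then obtain c where c: "cheb_poly k = [:c:]"
    by (metis degree_eq_zeroE not_gr_zero)
  show False
    using cheb_poly_cos[of k 0] cheb_poly_cos[of k "pi / real k"] assms by (simp add: c)
qed

section \<open>Polynomials in two variables\<close>

text \<open>Specialising the inner variable first leaves a polynomial in \<open>y\<close> alone,
  whose roots can be counted.\<close>

lemma poly_poly_eq_poly_map_poly:
  fixes F :: "'a::comm_ring_1 poly poly"
  shows "poly (poly F [:y:]) x = poly (map_poly (\<lambda>p. poly p x) F) y"
  by (induction F) (simp_all add: map_poly_pCons)

lemma in_y_simps [simp]: "degree (in_y p) = degree p" "lead_coeff (in_y p) = [:lead_coeff p:]"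
proof -
  show deg: "degree (in_y p) = degree p"
    unfolding in_y_def by (rule degree_map_poly) simp
  show "lead_coeff (in_y p) = [:lead_coeff p:]"
    unfolding deg by (simp add: in_y_def coeff_map_poly)
qed

text \<open>The denominator is cleared by a power of \<open>z\<close>, so that zeros can be handled
  by an ordinary polynomial. The value of \<open>f\<close> at 0 is left free.\<close>

definition is_laurent :: "(complex \<Rightarrow> complex) \<Rightarrow> bool" where
  "is_laurent f \<longleftrightarrow> (\<exists>N p. \<forall>z. z \<noteq> 0 \<longrightarrow> poly p z = z ^ N * f z)"

lemma is_laurent_const: "is_laurent (\<lambda>z. c)"
  unfolding is_laurent_def by (rule exI[of _ 0], rule exI[of _ "[:c:]"]) simp

lemma is_laurent_power: "is_laurent (\<lambda>z. z ^ k)"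
  unfolding is_laurent_def by (rule exI[of _ 0], rule exI[of _ "monom 1 k"]) (simp add: poly_monom)

lemma is_laurent_inverse_power: "is_laurent (\<lambda>z. inverse z ^ k)"
  unfolding is_laurent_def
  by (rule exI[of _ k], rule exI[of _ 1]) (simp add: power_mult_distrib[symmetric])

lemma is_laurent_mult:
  assumes "is_laurent f" "is_laurent g"
  shows "is_laurent (\<lambda>z. f z * g z)"
proof -
  obtain M p N q where "\<And>z. z \<noteq> 0 \<Longrightarrow> poly p z = z ^ M * f z"
    "\<And>z. z \<noteq> 0 \<Longrightarrow> poly q z = z ^ N * g z"
    using assms unfolding is_laurent_def by metis
  then show ?thesis
    unfolding is_laurent_def
    by (intro exI[of _ "M + N"] exI[of _ "p * q"]) (simp add: power_add)
qed

lemma is_laurent_add: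
  assumes "is_laurent f" "is_laurent g"
  shows "is_laurent (\<lambda>z. f z + g z)"
proof -
  obtain M p N q where "\<And>z. z \<noteq> 0 \<Longrightarrow> poly p z = z ^ M * f z"
    "\<And>z. z \<noteq> 0 \<Longrightarrow> poly q z = z ^ N * g z"
    using assms unfolding is_laurent_def by metis
  then show ?thesis
    unfolding is_laurent_def
    by (intro exI[of _ "M + N"] exI[of _ "monom 1 N * p + monom 1 M * q"])
      (simp add: power_add poly_monom algebra_simps)
qed

lemma is_laurent_poly:
  assumes "is_laurent f"
  shows "is_laurent (\<lambda>z. poly p (f z))"
  by (induction p) (simp_all add: is_laurent_const is_laurent_add is_laurent_mult assms)

lemma is_laurent_poly_poly:
  assumes "is_laurent f" "is_laurent g"
  shows "is_laurent (\<lambda>z. poly (poly F [:g z:]) (f z))"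
  by (induction F)
    (simp_all add: is_laurent_const is_laurent_add is_laurent_mult is_laurent_poly assms)

text \<open>Identity principle: the cleared numerator has infinitely many roots, hence is 0.\<close>

lemma is_laurent_eq_0:
  assumes "is_laurent f" and "infinite {z. z \<noteq> 0 \<and> f z = 0}" and "z \<noteq> 0"
  shows "f z = 0"
proof -
  obtain N p where p: "\<And>z. z \<noteq> 0 \<Longrightarrow> poly p z = z ^ N * f z"
    using assms(1) unfolding is_laurent_def by blast
  have "{z. z \<noteq> 0 \<and> f z = 0} \<subseteq> {z. poly p z = 0}"
    using p by auto
  then have "p = 0"
    using assms(2) finite_subset poly_roots_finite by blast
  then show ?thesis
    using p[OF assms(3)] assms(3) by simp
qed

text \<open>A constant nonzero leading coefficient of the product forces those of \<open>F\<close>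
  and \<open>G\<close> to be units. Specialising \<open>x\<close> therefore cannot annihilate
  \<open>F\<close>, and the roots in \<open>Y\<close> push its degree up to that of the product. So
  \<open>G\<close> has degree 0 and equals its unit leading coefficient.\<close>

lemma unit_of_mult_many_roots:
  fixes F G :: "'a::field poly poly"
  assumes "lead_coeff (F * G) = [:c:]" and "c \<noteq> 0"
    and "\<And>y. y \<in> Y \<Longrightarrow> poly (poly F [:y:]) x = 0" and "degree (F * G) \<le> card Y"
  shows "G dvd 1"
proof -
  have lc: "lead_coeff F * lead_coeff G = [:c:]"
    using assms(1) by (simp add: lead_coeff_mult)
  have unit: "[:c:] dvd 1"
    using assms(2) by (simp add: is_unit_const_poly_iff dvd_field_iff)
  have "lead_coeff F dvd 1"
    using lc unit by (metis dvd_trans dvd_triv_left)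
  then obtain f where f: "lead_coeff F = [:f:]" "f \<noteq> 0"
    by (auto simp: is_unit_poly_iff dvd_field_iff)
  have lG: "lead_coeff G dvd 1"
    using lc unit by (metis dvd_trans dvd_triv_right)
  define p where "p = map_poly (\<lambda>q. poly q x) F"
  have "coeff p (degree F) = f"
    unfolding p_def by (simp add: coeff_map_poly f)
  then have p0: "p \<noteq> 0"
    using f by auto
  have "Y \<subseteq> {y. poly p y = 0}"
    using assms(3) by (auto simp: p_def poly_poly_eq_poly_map_poly)
  then have "card Y \<le> card {y. poly p y = 0}"
    by (intro card_mono poly_roots_finite p0)
  also have "\<dots> \<le> degree p"
    by (rule card_poly_roots_bound[OF p0])
  also have "\<dots> \<le> degree F"
    unfolding p_def by (rule degree_le) (simp add: coeff_map_poly coeff_eq_0)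
  finally have "degree (F * G) \<le> degree F"
    using assms(4) by simp
  moreover have "F \<noteq> 0" "G \<noteq> 0"
    using lc assms(2) by auto
  ultimately have "degree G = 0"
    by (simp add: degree_mult_eq)
  then have "G = [:lead_coeff G:]"
    by (metis degree_eq_zeroE lead_coeff_pCons(2) pCons_0_0)
  then show ?thesis
    using lG by (metis is_unit_const_poly_iff)
qed

section \<open>The Lissajous curve\<close>

text \<open>The quotient is both an \<open>m\<close>-th and an \<open>n\<close>-th root of unity, so
  it is 1 by Bezout.\<close>

lemma power_eq_coprime_imp_eq:
  fixes a b :: "'a::field"
  assumes "coprime m n" "a ^ m = b ^ m" "a ^ n = b ^ n" "b \<noteq> 0" "m > 0"
  shows "a = b"
proof -
  define u where "u = a / b"
  have u: "u ^ m = 1" "u ^ n = 1"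
    using assms by (simp_all add: u_def power_divide)
  obtain k l where "m * k = n * l + gcd m n"
    using bezout_nat assms(5) by (metis less_numeral_extra(3))
  then have "u ^ (m * k) = u ^ (n * l) * u"
    using assms(1) by simp
  then have "u = 1"
    using u by (simp add: power_mult)
  then show ?thesis
    using assms(4) by (simp add: u_def)
qed

text \<open>The fibres of the Joukowski map: the difference of the two values is
  \<open>(a - b) * (a * b - 1)\<close> divided by \<open>a * b\<close>.\<close>

lemma add_inverse_eq_iff:
  fixes a b :: "'a::field"
  assumes "a \<noteq> 0" "b \<noteq> 0" "a + inverse a = b + inverse b"
  shows "a = b \<or> a * b = 1"
proof -
  have "(a - b) * (a * b - 1) = a * b * ((a + inverse a) - (b + inverse b))"
    using assms(1,2) by (simp add: field_simps)
  then show ?thesis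
    using assms(3) by simp
qed

text \<open>The Joukowski map applied to \<open>w * z ^ k\<close>. One definition serves both
  coordinates: \<open>lissajous m 1\<close> is \<open>x\<close> and \<open>lissajous n w\<close> is
  \<open>y\<close>.\<close>

definition lissajous :: "nat \<Rightarrow> complex \<Rightarrow> complex \<Rightarrow> complex" where
  "lissajous k w z = (w * z ^ k + inverse w * inverse z ^ k) / 2"

lemma is_laurent_lissajous: "is_laurent (lissajous k w)"
proof -
  have "is_laurent (\<lambda>z. (w * z ^ k + inverse w * inverse z ^ k) * (1 / 2))"
    by (intro is_laurent_mult is_laurent_add is_laurent_const is_laurent_power
        is_laurent_inverse_power)
  then show ?thesis
    by (simp add: lissajous_def[abs_def])
qed

lemma lissajous_cis: "lissajous k (cis a) (cis t) = complex_of_real (cos (real k * t + a))"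
proof -
  define b where "b = real k * t + a"
  have "cis a * cis t ^ k = cis b"
    by (simp add: DeMoivre cis_mult b_def add.commute)
  moreover have "inverse (cis a) * inverse (cis t) ^ k = inverse (cis b)"
    by (simp add: calculation[symmetric] power_inverse del: cis_inverse)
  ultimately show ?thesis
    unfolding b_def[symmetric] by (simp add: lissajous_def complex_eq_iff)
qed

lemma norm_root:
  fixes z :: complex
  assumes "z ^ m = complex_of_real r ^ m" "r > 0" "m > 0"
  shows "norm z = r"
proof -
  have "norm z ^ m = r ^ m"
    using assms(1,2) by (metis norm_of_real norm_power abs_of_pos)
  then show ?thesis
    using assms by (meson norm_ge_zero less_imp_le power_eq_imp_eq_base)
qed

text \<open>\<open>Z\<close> solves \<open>z ^ m + inverse z ^ m = 2 ^ m + inverse 2 ^ m\<close>.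
  Its points lie on the circles of radius 2 and 1/2, \<open>m\<close> on each, and the modulus tells
  which. If \<open>y\<close> agrees at two points \<open>a\<close> and \<open>b\<close>, either
  \<open>a ^ n = b ^ n\<close>, and coprimality gives \<open>a = b\<close>, or
  \<open>w * a ^ n\<close> and \<open>w * b ^ n\<close> are inverse, which would make
  \<open>w ^ (2 * m)\<close> equal to 1.\<close>

lemma lissajous_fibre:
  assumes "m > 0" "n > 0" "coprime m n" "norm w = 1" "w ^ (2 * m) \<noteq> 1"
  defines "Z \<equiv> {z. z ^ m = 2 ^ m} \<union> {z. z ^ m = (1 / 2) ^ m}"
  shows "\<And>z. z \<in> Z \<Longrightarrow> z \<noteq> 0 \<and> lissajous m 1 z = lissajous m 1 2"
    and "card (lissajous n w ` Z) = 2 * m"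
proof -
  show "z \<noteq> 0 \<and> lissajous m 1 z = lissajous m 1 2" if "z \<in> Z" for z
  proof -
    have "z ^ m \<noteq> 0"
    proof -
      have "z ^ m = 2 ^ m \<or> z ^ m = (1 / 2) ^ m"
        using that by (simp add: Z_def)
      moreover have "(2::complex) ^ m \<noteq> 0" "(1 / 2 :: complex) ^ m \<noteq> 0"
        by simp_all
      ultimately show ?thesis
        by metis
    qed
    then show ?thesis
      using that assms(1) by (auto simp: Z_def lissajous_def power_one_over power_inverse inverse_eq_divide)
  qed
  have norm_Z: "norm z = 2 \<and> z ^ m = 2 ^ m \<or> norm z = 1 / 2 \<and> z ^ m = (1 / 2) ^ m"
    if "z \<in> Z" for z
    using that norm_root[of z m 2] norm_root[of z m "1 / 2"] assms(1) by (auto simp: Z_def)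
  have w0: "w \<noteq> 0"
    using assms(4) by auto
  have "inj_on (lissajous n w) Z"
  proof (rule inj_onI)
    fix a b assume a: "a \<in> Z" and b: "b \<in> Z" and eq: "lissajous n w a = lissajous n w b"
    have ab0: "a \<noteq> 0" "b \<noteq> 0"
      using norm_Z[OF a] norm_Z[OF b] by auto
    have "w * a ^ n = w * b ^ n \<or> (w * a ^ n) * (w * b ^ n) = 1"
    proof (rule add_inverse_eq_iff)
      have "w * a ^ n + inverse w * inverse a ^ n = w * b ^ n + inverse w * inverse b ^ n"
        using eq unfolding lissajous_def by (metis divide_cancel_right zero_neq_numeral)
      then show "w * a ^ n + inverse (w * a ^ n) = w * b ^ n + inverse (w * b ^ n)"
        by (simp add: power_inverse)
    qed (use ab0 w0 in simp_all)
    then show "a = b"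
    proof
      assume "w * a ^ n = w * b ^ n"
      then have n: "a ^ n = b ^ n"
        using w0 by simp
      then have "norm a = norm b"
        using assms(2) by (metis norm_ge_zero norm_power power_eq_imp_eq_base)
      \<comment> \<open>Equal moduli put both points on the same circle of \<open>Z\<close>.\<close>
      then have "a ^ m = b ^ m"
        using norm_Z[OF a] norm_Z[OF b] by auto
      then show ?thesis
        using power_eq_coprime_imp_eq assms(1,3) n ab0 by blast
    next
      assume *: "(w * a ^ n) * (w * b ^ n) = 1"
      then have "norm ((w * a ^ n) * (w * b ^ n)) = 1"
        by simp
      then have "(norm a * norm b) ^ n = 1 ^ n"
        by (simp add: norm_mult norm_power assms(4) power_mult_distrib)
      then have "norm a * norm b = 1"
        using assms(2) power_eq_imp_eq_base[of "norm a * norm b" n 1] by simp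
      \<comment> \<open>A product of moduli equal to 1 puts the points on different circles of
        \<open>Z\<close>.\<close>
      then have "a ^ m * b ^ m = 2 ^ m * (1 / 2) ^ m"
        using norm_Z[OF a] norm_Z[OF b] by (elim disjE conjE) simp_all
      also have "\<dots> = 1"
        by (simp flip: power_mult_distrib)
      finally have ab: "a ^ m * b ^ m = 1" .
      have nm: "(c ^ n) ^ m = (c ^ m) ^ n" for c :: complex
        by (metis power_mult mult.commute)
      \<comment> \<open>The \<open>m\<close>-th power brings in \<open>a ^ m * b ^ m\<close>, which
        is 1, and leaves only \<open>w ^ (2 * m)\<close>.\<close>
      have "((w * a ^ n) * (w * b ^ n)) ^ m = w ^ (2 * m) * (a ^ m * b ^ m) ^ n"
        unfolding power_mult power_mult_distrib power2_eq_square nm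
        by (simp add: mult_ac)
      then show ?thesis
        using * ab assms(5) by simp
    qed
  qed
  moreover have "card Z = 2 * m"
  proof -
    have "{z::complex. z ^ m = 2 ^ m} \<inter> {z. z ^ m = (1 / 2) ^ m} = {}"
      using norm_root[of _ m 2] norm_root[of _ m "1 / 2"] assms(1) by fastforce
    moreover have "card {z::complex. z ^ m = c} = m" "finite {z::complex. z ^ m = c}" if "c \<noteq> 0" for c
      using that assms(1) by (auto intro: card_nth_roots finite_nth_roots)
    ultimately show ?thesis
      unfolding Z_def by (subst card_Un_disjoint) auto
  qed
  ultimately show "card (lissajous n w ` Z) = 2 * m"
    by (simp add: card_image)
qed

lemma infinite_unit_circle: "infinite {z::complex. norm z = 1}"
proof
  assume "finite {z::complex. norm z = 1}"
  moreover have "cis ` {0..pi} \<subseteq> {z. norm z = 1}"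
    by auto
  moreover have "inj_on cis {0..pi}"
    by (rule inj_onI) (auto simp: complex_eq_iff intro: cos_inj_pi)
  ultimately have "finite {0..pi}"
    using finite_imageD finite_subset by blast
  then show False
    by (simp add: infinite_Icc)
qed

section \<open>Irreducibility\<close>

definition lissajous_poly :: "nat \<Rightarrow> nat \<Rightarrow> real \<Rightarrow> complex poly poly" where
  "lissajous_poly m n \<delta> = (in_x (cheb_poly n))\<^sup>2
      - 2 * in_x (cheb_poly n) * in_y (cheb_poly m) * scalar (complex_of_real (cos \<delta>))
      + (in_y (cheb_poly m))\<^sup>2
      - scalar (complex_of_real ((sin \<delta>)\<^sup>2))"

text \<open>The phase \<open>\<delta> / m\<close> is multiplied by \<open>m\<close> under
  \<open>cheb_poly m\<close>, so the two Chebyshev values are \<open>cos a\<close> and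
  \<open>cos (a + \<delta>)\<close> with \<open>a = m * n * t\<close>. The claim becomes an identity
  that follows from the addition formula and the Pythagorean relations.\<close>

lemma lissajous_poly_eq_0:
  assumes "m > 0" "norm z = 1"
  shows "poly (poly (lissajous_poly m n \<delta>) [:lissajous n (cis (\<delta> / real m)) z:]) (lissajous m 1 z) = 0"
proof -
  obtain t where z: "z = cis t"
    using assms(2) by (metis cis_Arg norm_eq_zero sgn_eq div_by_1 of_real_1 zero_neq_one)
  have x: "lissajous m 1 z = complex_of_real (cos (real m * t))"
    using lissajous_cis[of m 0 t] by (simp add: z)
  have y: "lissajous n (cis (\<delta> / real m)) z = complex_of_real (cos (real n * t + \<delta> / real m))"
    by (simp add: z lissajous_cis)
  define a where "a = real m * (real n * t)"
  have "real n * (real m * t) = a" "real m * (real n * t + \<delta> / real m) = a + \<delta>"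
    using assms(1) by (simp_all add: a_def algebra_simps)
  moreover have "(cos a)\<^sup>2 - 2 * cos a * cos (a + \<delta>) * cos \<delta> + (cos (a + \<delta>))\<^sup>2 - (sin \<delta>)\<^sup>2 = 0"
  proof -
    have "(cos a)\<^sup>2 + (sin a)\<^sup>2 = 1" "(cos \<delta>)\<^sup>2 + (sin \<delta>)\<^sup>2 = 1"
      by simp_all
    then show ?thesis
      unfolding cos_add by algebra
  qed
  then have "complex_of_real ((cos a)\<^sup>2 - 2 * cos a * cos (a + \<delta>) * cos \<delta> + (cos (a + \<delta>))\<^sup>2 - (sin \<delta>)\<^sup>2) = 0"
    by simp
  ultimately show ?thesis
    by (simp add: lissajous_poly_def x y poly_in_x poly_in_y poly_scalar cheb_poly_cos)
qed

text \<open>The polynomial has the form \<open>C - B * Y + Y^2\<close> with \<open>B\<close> and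
  \<open>C\<close> free of \<open>y\<close>; since \<open>Y\<close> has positive degree, the square
  dominates.\<close>

lemma degree_lissajous_poly:
  assumes "m > 0"
  shows "degree (lissajous_poly m n \<delta>) = 2 * degree (cheb_poly m)"
    and "lead_coeff (lissajous_poly m n \<delta>) = [:(lead_coeff (cheb_poly m))\<^sup>2:]"
proof -
  define Y where "Y = in_y (cheb_poly m)"
  define C where "C = (in_x (cheb_poly n))\<^sup>2 - scalar (complex_of_real ((sin \<delta>)\<^sup>2))"
  define B where "B = 2 * cheb_poly n * [:complex_of_real (cos \<delta>):]"
  have dY: "degree Y > 0" "degree Y = degree (cheb_poly m)"
    using degree_cheb_poly_pos[OF assms] by (simp_all add: Y_def)
  have "2 * in_x (cheb_poly n) * Y * scalar (complex_of_real (cos \<delta>)) = smult B Y"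
    by (simp add: in_x_def scalar_def B_def numeral_poly mult.commute mult.left_commute)
  then have eq: "lissajous_poly m n \<delta> = (C - smult B Y) + Y\<^sup>2"
    by (simp add: lissajous_poly_def C_def Y_def)
  have d2: "degree (Y\<^sup>2) = 2 * degree Y"
    by (rule degree_power_eq) (use dY in auto)
  have "degree C = 0"
    by (simp add: C_def in_x_def scalar_def power2_eq_square)
  then have "degree (C - smult B Y) \<le> degree Y"
    by (intro degree_diff_le) (use degree_smult_le[of B Y] in simp_all)
  then have less: "degree (C - smult B Y) < degree (Y\<^sup>2)"
    using dY d2 by simp
  show "degree (lissajous_poly m n \<delta>) = 2 * degree (cheb_poly m)"
    unfolding eq by (subst degree_add_eq_right[OF less]) (simp add: d2 dY)
  show "lead_coeff (lissajous_poly m n \<delta>) = [:(lead_coeff (cheb_poly m))\<^sup>2:]"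
    unfolding eq lead_coeff_add_le[OF less]
    by (simp only: lead_coeff_power Y_def in_y_simps(2)) (simp add: power2_eq_square)
qed

lemma irreducible_lissajous_poly:
  assumes "m > 0" "n > 0" "coprime m n" "sin \<delta> \<noteq> 0"
  shows "irreducible (lissajous_poly m n \<delta>)"
proof (rule irreducibleI)
  let ?P = "lissajous_poly m n \<delta>"
  have T: "degree (cheb_poly m) > 0"
    by (rule degree_cheb_poly_pos[OF assms(1)])
  then have lc: "(lead_coeff (cheb_poly m))\<^sup>2 \<noteq> 0"
    by auto
  show "?P \<noteq> 0"
    using T degree_lissajous_poly(1)[OF assms(1), of n \<delta>] by auto
  show "\<not> ?P dvd 1"
    using T degree_lissajous_poly(1)[OF assms(1), of n \<delta>] by (auto simp: is_unit_poly_iff)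
  define w where "w = cis (\<delta> / real m)"
  have "w ^ (2 * m) = cis (2 * \<delta>)"
    using assms(1) by (simp add: w_def DeMoivre)
  \<comment> \<open>Here \<open>sin \<delta> \<noteq> 0\<close> enters:
    \<open>cos (2 * \<delta>) = 1 - 2 * (sin \<delta>)^2\<close>.\<close>
  moreover have "cis (2 * \<delta>) \<noteq> 1"
  proof
    assume "cis (2 * \<delta>) = 1"
    then have "cos (2 * \<delta>) = 1"
      by (simp add: complex_eq_iff)
    then show False
      using assms(4) by (simp add: cos_double_sin)
  qed
  ultimately have w: "norm w = 1" "w ^ (2 * m) \<noteq> 1"
    by (simp_all add: w_def)
  \<comment> \<open>The pullback of a bivariate polynomial along the curve.\<close>
  define h where "h = (\<lambda>F z. poly (poly F [:lissajous n w z:]) (lissajous m 1 z))"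
  \<comment> \<open>Stated for arbitrary \<open>F\<close> and \<open>G\<close>, so that it applies
    to the two factors in either order.\<close>
  have unit: "G dvd 1" if FG: "?P = F * G" and inf: "infinite {z. z \<noteq> 0 \<and> h F z = 0}" for F G
  proof -
    have van: "h F z = 0" if "z \<noteq> 0" for z
      using is_laurent_eq_0[OF _ inf that] is_laurent_poly_poly is_laurent_lissajous
      by (simp add: h_def)
    note fibre = lissajous_fibre[OF assms(1-3) w]
    show ?thesis
    proof (rule unit_of_mult_many_roots)
      show "lead_coeff (F * G) = [:(lead_coeff (cheb_poly m))\<^sup>2:]"
        using degree_lissajous_poly(2)[OF assms(1)] FG by metis
      fix y assume "y \<in> lissajous n w ` ({z. z ^ m = 2 ^ m} \<union> {z. z ^ m = (1 / 2) ^ m})"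
      then obtain z where y: "y = lissajous n w z"
        and z: "z \<in> {z. z ^ m = 2 ^ m} \<union> {z. z ^ m = (1 / 2) ^ m}"
        by (rule imageE)
      then show "poly (poly F [:y:]) (lissajous m 1 2) = 0"
        using fibre(1)[OF z] van[of z] unfolding h_def y by (elim conjE) simp
    next
      show "degree (F * G) \<le> card (lissajous n w ` ({z. z ^ m = 2 ^ m} \<union> {z. z ^ m = (1 / 2) ^ m}))"
        unfolding fibre(2) FG[symmetric] degree_lissajous_poly(1)[OF assms(1)]
        using degree_cheb_poly_le[of m] by simp
    qed (rule lc)
  qed
  fix F G assume FG: "?P = F * G"
  \<comment> \<open>The product vanishes on the whole infinite circle, so at least one factor has
    infinitely many zeros there.\<close>
  have "{z. norm z = 1} \<subseteq> {z. z \<noteq> 0 \<and> h F z = 0} \<union> {z. z \<noteq> 0 \<and> h G z = 0}"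
  proof
    fix z :: complex assume "z \<in> {z. norm z = 1}"
    then have z: "norm z = 1"
      by simp
    then have "h F z * h G z = 0"
      using lissajous_poly_eq_0[OF assms(1) z, of n \<delta>] by (simp add: FG h_def w_def)
    then show "z \<in> {z. z \<noteq> 0 \<and> h F z = 0} \<union> {z. z \<noteq> 0 \<and> h G z = 0}"
      using z by auto
  qed
  then have "infinite {z. z \<noteq> 0 \<and> h F z = 0} \<or> infinite {z. z \<noteq> 0 \<and> h G z = 0}"
    using infinite_unit_circle finite_subset by blast
  then show "F dvd 1 \<or> G dvd 1"
    using unit[OF FG] unit[of G F] FG by (auto simp: mult.commute)
qed

theorem theorem4:
  fixes m n :: nat and \<delta> :: real
  assumes "m > 0" and "n > 0" and "coprime m n" and "sin \<delta> \<noteq> 0"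
  shows "irreducible
    ((in_x (cheb_poly n))\<^sup>2
      - 2 * in_x (cheb_poly n) * in_y (cheb_poly m) * scalar (complex_of_real (cos \<delta>))
      + (in_y (cheb_poly m))\<^sup>2
      - scalar (complex_of_real ((sin \<delta>)\<^sup>2)))"
  using irreducible_lissajous_poly[OF assms] by (simp only: lissajous_poly_def)

end
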